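(* Let $A,B,C,D,k\in\mathbb{Z}$, where $k$ is odd and every prime divisor $p$ of $k$ satisfies $p\equiv 1\pmod 4$. Let $E$ be the algebraic curve $y^2=Ax^3+Bx^2+Cx+D$. Suppose that $$-3A+C\equiv -1\pmod 4,\qquad A-B+C\equiv -1\pmod 4,\qquad k^2=A-B+C-D.$$ Then $E$ has no positive integer solutions with $x>1$, $y\ge 1$; that is, there are no integers $x,y$ with $x>1$, $y\ge 1$ and $y^2=Ax^3+Bx^2+Cx+D$.
   Context: The condition on the prime divisors of $k$ is vacuous when $k=\pm1$. No nonsingularity of the curve is assumed. *)

theory Defs
  imports "HOL-Number_Theory.Cong"
begin

end

theory Submission
  imports Defs "HOL-Number_Theory.Residues"
begin

text \<open>
  Adding \<^term>\<open>k ^ 2\<close> to the equation of the curve makes the right-hand side vanish at \<open>x = -1\<close>,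
  so it splits off a factor: \<open>y\<^sup>2 + k\<^sup>2 = (x + 1) Q\<close> with \<open>Q = A (x\<^sup>2 - x + 1) + B (x - 1) + C\<close>.
  The left-hand side is a sum of two squares in which a prime congruent to 3 modulo 4 can divide
  only if it divides \<open>k\<close>, and the hypothesis on \<open>k\<close> excludes this. Hence no positive divisor of
  \<open>y\<^sup>2 + k\<^sup>2\<close> is congruent to 3 modulo 4; and since \<open>k\<close> is odd, 4 is no divisor either.
  The congruences on the coefficients say that \<open>4 dvd B\<close> and \<open>C \<equiv> 3 A - 1\<close>, so that
  \<open>Q \<equiv> A x (x - 1) - 1\<close> modulo 4. Therefore each residue of \<open>x\<close> produces a forbidden divisor:
  \<open>Q\<close> if \<open>x \<equiv> 0, 1\<close>, and \<open>x + 1\<close> if \<open>x \<equiv> 2, 3\<close>.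
\<close>

text \<open>
  For \<open>p = 4 m + 3\<close> the exponent \<open>(p - 1) / 2 = 2 m + 1\<close> is odd. If \<open>p\<close> did not divide \<open>b\<close>, raising
  \<open>a\<^sup>2 \<equiv> - b\<^sup>2\<close> to this power would give \<open>1 \<equiv> -1\<close> by Fermat's little theorem.
\<close>

lemma prime_3_mod_4_dvd_sum_squares:
  fixes a b p :: int
  assumes "prime p" and p3: "[p = 3] (mod 4)" and dvd: "p dvd a\<^sup>2 + b\<^sup>2"
  shows "p dvd b"
proof (rule ccontr)
  assume nb: "\<not> p dvd b"
  have na: "\<not> p dvd a"
  proof
    assume "p dvd a"
    then have "p dvd b\<^sup>2"
      using dvd by (simp add: dvd_add_right_iff power2_eq_square)
    with nb show False
      using \<open>prime p\<close> prime_dvd_power by blast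
  qed
  define m where "m = nat (p div 4)"
  have "p = 4 * (p div 4) + 3"
    using p3 unfolding cong_def by presburger
  then have p: "p = int (4 * m + 3)"
    using prime_gt_0_int[OF \<open>prime p\<close>] by (simp add: m_def pos_imp_zdiv_nonneg_iff)
  have fermat: "[c ^ (4 * m + 2) = 1] (mod p)" if "\<not> p dvd c" for c :: int
  proof -
    have "prime (4 * m + 3)"
      using \<open>prime p\<close> p by (metis prime_nat_int_transfer)
    define d where "d = nat (c mod p)"
    have d: "int d = c mod p"
      using prime_gt_0_int[OF \<open>prime p\<close>] by (simp add: d_def)
    have "\<not> 4 * m + 3 dvd d"
      using that d p by (metis dvd_mod_iff dvd_refl int_dvd_int_iff)
    then have "[d ^ (4 * m + 3 - 1) = 1] (mod (4 * m + 3))"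
      using \<open>prime (4 * m + 3)\<close> fermat_theorem by blast
    then have "[int d ^ (4 * m + 2) = 1] (mod p)"
      using cong_int_iff[of "d ^ (4 * m + 2)" 1 "4 * m + 3"] p by simp
    then show ?thesis
      by (simp only: d cong_def power_mod)
  qed
  have "[a\<^sup>2 = - (b\<^sup>2)] (mod p)"
    using dvd by (simp add: cong_iff_dvd_diff)
  then have "[(a\<^sup>2) ^ (2 * m + 1) = (- (b\<^sup>2)) ^ (2 * m + 1)] (mod p)"
    by (rule cong_pow)
  moreover have "(- (b\<^sup>2)) ^ (2 * m + 1) = - ((b\<^sup>2) ^ (2 * m + 1))"
    by simp
  moreover have "(c\<^sup>2) ^ (2 * m + 1) = c ^ (4 * m + 2)" for c :: int
    using power_mult[of c 2 "2 * m + 1"] by (simp del: power_Suc)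
  ultimately have "[a ^ (4 * m + 2) = - (b ^ (4 * m + 2))] (mod p)"
    by metis
  moreover have "[- (b ^ (4 * m + 2)) = - 1] (mod p)"
    using fermat[OF nb] by (simp only: cong_minus_minus_iff)
  ultimately have "[1 = - 1] (mod p)"
    using fermat[OF na] by (meson cong_sym cong_trans)
  then have "p dvd 2"
    by (simp add: cong_iff_dvd_diff)
  then have "p \<le> 2"
    by (simp add: zdvd_imp_le)
  then show False
    using p by simp
qed

text \<open>
  A product of numbers congruent to 1 modulo 4 is again congruent to 1, so the prime factors of a
  number congruent to 3 cannot all lie in that class; none of them is 2.
\<close>

lemma prime_divisor_3_mod_4:
  fixes n :: int
  assumes "n > 0" and "[n = 3] (mod 4)"
  obtains p where "prime p" and "p dvd n" and "[p = 3] (mod 4)"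
proof -
  have "odd n"
    using assms(2) by (auto simp: cong_def) presburger
  have "\<exists>p\<in>prime_factors n. [p = 3] (mod 4)"
  proof (rule ccontr)
    assume none: "\<not> ?thesis"
    have one: "[p = 1] (mod 4)" if "p \<in> prime_factors n" for p
    proof -
      have "p dvd n"
        using that by auto
      with \<open>odd n\<close> have "odd p"
        by (meson dvd_trans)
      moreover have "p mod 4 \<noteq> 3"
        using none that by (auto simp: cong_def)
      ultimately show ?thesis
        unfolding cong_def by presburger
    qed
    have "[(\<Prod>p\<in>prime_factors n. p ^ multiplicity p n) = (\<Prod>p\<in>prime_factors n. 1)] (mod 4)"
      using one by (intro cong_prod) (metis cong_pow power_one)
    then have "[n = 1] (mod 4)"
      using \<open>n > 0\<close> prod_prime_factors[of n] by simp
    with assms(2) show False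
      by (simp add: cong_def)
  qed
  then show thesis
    using that by auto
qed

theorem theorem5:
  fixes A B C D k :: int
  assumes "odd k"
    and "\<And>p :: int. prime p \<Longrightarrow> p dvd k \<Longrightarrow> [p = 1] (mod 4)"
    and "[- 3 * A + C = - 1] (mod 4)"
    and "[A - B + C = - 1] (mod 4)"
    and "k ^ 2 = A - B + C - D"
  shows "\<not> (\<exists>x y :: int. x > 1 \<and> y \<ge> 1 \<and> y ^ 2 = A * x ^ 3 + B * x ^ 2 + C * x + D)"
proof
  assume "\<exists>x y :: int. x > 1 \<and> y \<ge> 1 \<and> y ^ 2 = A * x ^ 3 + B * x ^ 2 + C * x + D"
  then obtain x y :: int
    where "x > 1" and "y \<ge> 1" and curve: "y\<^sup>2 = A * x ^ 3 + B * x\<^sup>2 + C * x + D"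
    by blast
  define Q where "Q = A * (x\<^sup>2 - x + 1) + B * (x - 1) + C"
  have factor: "y\<^sup>2 + k\<^sup>2 = (x + 1) * Q"
    unfolding Q_def curve assms(5)
    by (simp add: algebra_simps power2_eq_square power3_eq_cube)
  have "y\<^sup>2 + k\<^sup>2 > 0"
    using \<open>y \<ge> 1\<close> by (simp add: add_pos_nonneg)
  then have "Q > 0"
    using \<open>x > 1\<close> by (simp add: factor zero_less_mult_iff)

  have no_3_mod_4: "\<not> [d = 3] (mod 4)" if "d > 0" "d dvd y\<^sup>2 + k\<^sup>2" for d
  proof
    assume "[d = 3] (mod 4)"
    with \<open>d > 0\<close> obtain p where p: "prime p" "p dvd d" "[p = 3] (mod 4)"
      by (rule prime_divisor_3_mod_4)
    then have "p dvd k"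
      using that by (meson dvd_trans prime_3_mod_4_dvd_sum_squares)
    with p assms(2) have "[p = 1] (mod 4)"
      by blast
    with p(3) show False
      by (simp add: cong_def)
  qed

  have not_4_dvd: "\<not> 4 dvd y\<^sup>2 + k\<^sup>2"
  proof -
    obtain j where k: "k = 2 * j + 1"
      using \<open>odd k\<close> by (rule oddE)
    obtain i where "y = 2 * i \<or> y = 2 * i + 1"
      by (meson evenE oddE)
    then have "y\<^sup>2 + k\<^sup>2 = 4 * (i\<^sup>2 + j\<^sup>2 + j) + 1 \<or> y\<^sup>2 + k\<^sup>2 = 4 * (i\<^sup>2 + i + j\<^sup>2 + j) + 2"
      by (auto simp: k power2_eq_square algebra_simps)
    then show ?thesis
      by presburger
  qed

  obtain b where b: "B = 4 * b"
  proof -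
    have "4 dvd (- 3 * A + C + 1) - (A - B + C + 1)"
      using assms(3,4) by (intro dvd_diff) (auto simp: cong_iff_dvd_diff)
    then have "4 dvd B"
      by presburger
    then show thesis
      using that by (auto elim: dvdE)
  qed
  obtain c where c: "C = 3 * A - 1 + 4 * c"
  proof -
    have "4 dvd C - (3 * A - 1)"
      using assms(3) by (simp add: cong_iff_dvd_diff algebra_simps)
    then obtain c where "C - (3 * A - 1) = 4 * c" ..
    then show thesis
      using that[of c] by simp
  qed
  have Q: "Q = A * (x * (x - 1)) - 1 + 4 * (A + b * (x - 1) + c)"
    by (simp add: Q_def b c algebra_simps power2_eq_square)

  consider "4 dvd x * (x - 1)" | "[x + 1 = 3] (mod 4)" | "4 dvd x + 1"
  proof -
    have "4 dvd x \<or> 4 dvd x - 1 \<or> (x + 1) mod 4 = 3 \<or> 4 dvd x + 1"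
      by presburger
    then show thesis
      using that by (auto simp: cong_def)
  qed
  then show False
  proof cases
    case 1
    then have "4 dvd A * (x * (x - 1)) + 4 * (A + b * (x - 1) + c - 1)"
      by (intro dvd_add) simp_all
    then have "[Q = 3] (mod 4)"
      by (simp add: Q cong_iff_dvd_diff algebra_simps)
    with \<open>Q > 0\<close> show False
      using no_3_mod_4 by (simp add: factor)
  next
    case 2
    with \<open>x > 1\<close> show False
      using no_3_mod_4[of "x + 1"] by (simp add: factor)
  next
    case 3
    then show False
      using not_4_dvd by (simp add: factor)
  qed
qed

end
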